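(* Let the loss function be the $N$-gram Hamming loss, and let $p$ be a probability distribution over $\mathcal{X}\times\mathcal{Y}$. For $x\in\mathcal X$ let $g(y\mid x)=\sum_{i=1}^{L-N+1}p(y_{i:i+N-1}\mid x)$. Then any stochastic decoder $\mathcal D$ which, for a set of inputs $x$ of non-zero probability, has a non-zero probability of outputting some $\hat y\in\mathcal{Y}$ with $\hat y\notin\arg\max_{y\in\mathcal Y}g(y\mid x)$ is not optimal for $p$.
   Context: $\mathcal X$ is an input (measurable) space and $\mathcal Y$ is a finite set of sequences of length $L$ over a finite alphabet (a vocabulary together with a null padding token). Notation: $y_{i:j}=y_i\cdots y_j$, $1\le N\le L$; $p(y_{i:i+N-1}\mid x)$ is the marginal probability, under the conditional distribution $p(\cdot\mid x)$ of the output given $x$, that positions $i,\dots,i+N-1$ equal $y_{i:i+N-1}$. The $N$-gram Hamming loss is $\ell(\hat y,y)=\sum_{i=1}^{L-N+1}\mathbf 1\{\hat y_{i:i+N-1}\ne y_{i:i+N-1}\}$. A decoder $\mathcal D$ takes an input $x$ and the next-token conditional probabilities of $p$ and outputs a sequence in $\mathcal Y$; it may use internal randomness (stochastic decoder), independent of the true output $y$ given $x$. The distribution of its output on input $x$ is denoted $p_{\mathcal D(p)\mid x}$. Its risk is $\mathbb E_{x\sim p_x}\,\mathbb E_{y\sim p(\cdot\mid x),\ \hat y\sim p_{\mathcal D(p)\mid x}}[\ell(\hat y,y)]$, with $p_x$ the marginal of $p$ on $\mathcal X$. $\mathcal D$ is optimal for $p$ if its risk equals $\inf_{h:\mathcal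 X\to\mathcal Y}\mathbb E_{(x,y)\sim p}[\ell(h(x),y)]$ (infimum over measurable $h$). *)

theory Defs
  imports "HOL-Probability.Probability" "HOL-Library.Sublist"
begin

text \<open>
  Positions are counted from \<open>0\<close>, so the \<open>N\<close>-grams of a sequence of length \<open>L\<close>
  (with \<open>1 \<le> N \<le> L\<close>) start at the positions \<open>0, \<dots>, L - N\<close>.
\<close>

definition ngram :: "nat \<Rightarrow> nat \<Rightarrow> 'a list \<Rightarrow> 'a list" where
  "ngram N i y = take N (drop i y)"

definition ngram_hamming_loss :: "nat \<Rightarrow> nat \<Rightarrow> 'a list \<Rightarrow> 'a list \<Rightarrow> real" where
  "ngram_hamming_loss N L yhat y = (\<Sum>i=0..L - N. of_bool (ngram N i yhat \<noteq> ngram N i y))"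

text \<open>
  Markov kernels from \<open>M\<close> to the finite set \<open>Y\<close> are the elements of
  \<open>M \<rightarrow>\<^sub>M prob_algebra (count_space Y)\<close>. The output space being finite, a conditional
  distribution of the output given the input always exists, but it is unique only up to null
  sets of inputs; the following predicate holds for each of its versions.
\<close>

definition is_cond_distribution ::
  "'x measure \<Rightarrow> 'y set \<Rightarrow> ('x \<times> 'y) measure \<Rightarrow> ('x \<Rightarrow> 'y measure) \<Rightarrow> bool" where
  "is_cond_distribution M Y p \<kappa> \<longleftrightarrow>
     \<kappa> \<in> M \<rightarrow>\<^sub>M prob_algebra (count_space Y) \<and>
     (\<forall>A\<in>sets M. \<forall>B\<subseteq>Y.
        emeasure p (A \<times> B) = (\<integral>\<^sup>+x\<in>A. emeasure (\<kappa> x) B \<partial>(distr p M fst)))"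

text \<open>
  The conditional probability of the token \<open>a\<close> after the prefix \<open>s\<close>, given \<open>x\<close>. It is \<open>0\<close> by
  convention if \<open>s\<close> has probability \<open>0\<close>.
\<close>

definition next_token_prob :: "('x \<Rightarrow> 'a list measure) \<Rightarrow> 'x \<Rightarrow> 'a list \<Rightarrow> 'a \<Rightarrow> real" where
  "next_token_prob \<kappa> x s a = cond_prob (\<kappa> x) (prefix (s @ [a])) (prefix s)"

text \<open>
  A decoder is given the next-token probabilities and an input, and \<open>D q x\<close> is the distribution
  of its output. Deterministic decoders are those for which \<open>D q x\<close> is a point mass.
\<close>

type_synonym ('x, 'a) decoder = "('x \<Rightarrow> 'a list \<Rightarrow> 'a \<Rightarrow> real) \<Rightarrow> 'x \<Rightarrow> 'a list measure"

definition stochastic_decoder :: "'x measure \<Rightarrow> 'a list set \<Rightarrow> ('x, 'a) decoder \<Rightarrow> bool" where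
  "stochastic_decoder M Y D \<longleftrightarrow>
     (\<forall>\<kappa> \<in> M \<rightarrow>\<^sub>M prob_algebra (count_space Y).
        D (next_token_prob \<kappa>) \<in> M \<rightarrow>\<^sub>M prob_algebra (count_space Y))"

text \<open>
  The product measure expresses that, given \<open>x\<close>, the randomness of the decoder is independent
  of the true output.
\<close>

definition decoder_risk ::
  "('y \<Rightarrow> 'y \<Rightarrow> real) \<Rightarrow> 'x measure \<Rightarrow> ('x \<times> 'y) measure \<Rightarrow> ('x \<Rightarrow> 'y measure) \<Rightarrow>
   ('x \<Rightarrow> 'y measure) \<Rightarrow> real" where
  "decoder_risk loss M p \<kappa> K =
     (\<integral>x. (\<integral>(y, yhat). loss yhat y \<partial>(\<kappa> x \<Otimes>\<^sub>M K x)) \<partial>(distr p M fst))"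

definition minimal_risk ::
  "('y \<Rightarrow> 'y \<Rightarrow> real) \<Rightarrow> 'x measure \<Rightarrow> 'y set \<Rightarrow> ('x \<times> 'y) measure \<Rightarrow> real" where
  "minimal_risk loss M Y p = (INF h\<in>M \<rightarrow>\<^sub>M count_space Y. \<integral>(x, y). loss (h x) y \<partial>p)"

definition optimal_decoder ::
  "('a list \<Rightarrow> 'a list \<Rightarrow> real) \<Rightarrow> 'x measure \<Rightarrow> 'a list set \<Rightarrow> ('x \<times> 'a list) measure \<Rightarrow>
   ('x \<Rightarrow> 'a list measure) \<Rightarrow> ('x, 'a) decoder \<Rightarrow> bool" where
  "optimal_decoder loss M Y p \<kappa> D \<longleftrightarrow>
     decoder_risk loss M p \<kappa> (D (next_token_prob \<kappa>)) = minimal_risk loss M Y p"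

definition ngram_score ::
  "nat \<Rightarrow> nat \<Rightarrow> ('x \<Rightarrow> 'a list measure) \<Rightarrow> 'x \<Rightarrow> 'a list \<Rightarrow> real" where
  "ngram_score N L \<kappa> x y = (\<Sum>i=0..L - N. \<P>(z in \<kappa> x. ngram N i z = ngram N i y))"

end

theory Submission
  imports Defs
begin

text \<open>
  Given \<open>x\<close>, the expected \<open>N\<close>-gram Hamming loss of the output \<open>a\<close> is
  \<open>L - N + 1 - g(a | x)\<close>, so the maximizers of \<open>g(\<cdot> | x)\<close> are exactly the minimizers of the
  conditional risk. Since the output space is finite, a minimizer can be selected measurably in
  \<open>x\<close>; the conditional risk of this predictor is a pointwise lower bound for that of the decoder,
  strict on a set of positive probability, and hence strict after integration.
\<close>

section \<open>Integrals and Markov kernels over a finite output space\<close>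

lemma integral_finite_space:
  fixes f :: "'y \<Rightarrow> real"
  assumes "prob_space Q" "sets Q = Pow Y" "finite Y"
  shows "(\<integral>y. f y \<partial>Q) = (\<Sum>y\<in>Y. f y * measure Q {y})"
proof -
  interpret prob_space Q by fact
  have sp: "space Q = Y" using assms(2) by (metis sets_eq_imp_space_eq sets_count_space space_count_space)
  have "(\<integral>y. f y \<partial>Q) = (\<integral>z. (\<Sum>y\<in>Y. f y * indicator {y} z) \<partial>Q)"
    using assms(3) by (intro Bochner_Integration.integral_cong)
      (auto simp: sp indicator_def if_distrib sum.delta cong: if_cong)
  also have "\<dots> = (\<Sum>y\<in>Y. \<integral>z. f y * indicator {y} z \<partial>Q)"
    by (intro Bochner_Integration.integral_sum integrable_mult_right)
      (auto simp: assms(2) sp less_top[symmetric])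
  also have "\<dots> = (\<Sum>y\<in>Y. f y * measure Q {y})"
    by (intro sum.cong) (auto simp: sp assms(2) Int_absorb2)
  finally show ?thesis .
qed

lemma kernel_prob_algebra:
  assumes "K \<in> M \<rightarrow>\<^sub>M prob_algebra (count_space Y)" "x \<in> space M"
  shows "prob_space (K x)" "sets (K x) = Pow Y"
  using measurable_space[OF assms] by (auto simp: space_prob_algebra)

lemma measurable_kernel_measure:
  assumes "K \<in> M \<rightarrow>\<^sub>M prob_algebra (count_space Y)" "A \<subseteq> Y"
  shows "(\<lambda>x. measure (K x) A) \<in> borel_measurable M"
  using measurable_compose[OF measurable_prob_algebraD[OF assms(1)]
      measurable_measure_subprob_algebra] assms(2) by simp

section \<open>Conditional risk and its integral over the inputs\<close>

text \<open>This is the posterior expected loss of the action \<open>a\<close> after observing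
  \<open>x\<close>. The loss is kept arbitrary, so that \<open>N\<close>-grams enter only at the
  end.\<close>

definition conditional_risk :: "('y \<Rightarrow> 'y \<Rightarrow> real) \<Rightarrow> ('x \<Rightarrow> 'y measure) \<Rightarrow> 'x \<Rightarrow> 'y \<Rightarrow> real" where
  "conditional_risk loss \<kappa> x a = (\<integral>y. loss a y \<partial>\<kappa> x)"

lemma conditional_risk_finite_space:
  assumes "\<kappa> \<in> M \<rightarrow>\<^sub>M prob_algebra (count_space Y)" "finite Y" "x \<in> space M"
  shows "conditional_risk loss \<kappa> x a = (\<Sum>y\<in>Y. loss a y * measure (\<kappa> x) {y})"
  using kernel_prob_algebra[OF assms(1,3)] assms(2)
  by (simp add: conditional_risk_def integral_finite_space)

lemma measurable_conditional_risk:
  assumes "\<kappa> \<in> M \<rightarrow>\<^sub>M prob_algebra (count_space Y)" "finite Y"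
  shows "(\<lambda>x. conditional_risk loss \<kappa> x a) \<in> borel_measurable M"
proof (subst measurable_cong[OF conditional_risk_finite_space[OF assms]])
  show "(\<lambda>x. \<Sum>y\<in>Y. loss a y * measure (\<kappa> x) {y}) \<in> borel_measurable M"
    by (intro borel_measurable_sum borel_measurable_times borel_measurable_const
        measurable_kernel_measure[OF assms(1)]) auto
qed

text \<open>All weights \<open>measure (\<kappa> x) {y}\<close> are at most 1. The bound is free of
  \<open>x\<close>, which later yields integrability over the input marginal.\<close>

lemma abs_conditional_risk_le:
  assumes "\<kappa> \<in> M \<rightarrow>\<^sub>M prob_algebra (count_space Y)" "finite Y" "x \<in> space M"
  shows "\<bar>conditional_risk loss \<kappa> x a\<bar> \<le> (\<Sum>y\<in>Y. \<bar>loss a y\<bar>)"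
proof -
  interpret K: prob_space "\<kappa> x" using kernel_prob_algebra[OF assms(1,3)] by simp
  show ?thesis unfolding conditional_risk_finite_space[OF assms]
    by (intro order_trans[OF sum_abs] sum_mono) (simp add: abs_mult mult_left_le)
qed

text \<open>Independence of \<open>y\<close> and \<open>yhat\<close> given \<open>x\<close> makes
  the point masses of the product factor, so the expected loss is the average of the conditional
  risks, weighted by the decoder's output probabilities.\<close>

lemma integral_loss_product:
  fixes loss :: "'y \<Rightarrow> 'y \<Rightarrow> real"
  assumes k: "\<kappa> \<in> M \<rightarrow>\<^sub>M prob_algebra (count_space Y)"
    and K: "K \<in> M \<rightarrow>\<^sub>M prob_algebra (count_space Y)"
    and fin: "finite Y" and x: "x \<in> space M"
  shows "(\<integral>(y, yhat). loss yhat y \<partial>(\<kappa> x \<Otimes>\<^sub>M K x)) =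
    (\<Sum>a\<in>Y. measure (K x) {a} * conditional_risk loss \<kappa> x a)"
proof -
  interpret k: prob_space "\<kappa> x" using kernel_prob_algebra[OF k x] by simp
  interpret K: prob_space "K x" using kernel_prob_algebra[OF K x] by simp
  interpret P: pair_prob_space "\<kappa> x" "K x" ..
  note s = kernel_prob_algebra(2)[OF k x] kernel_prob_algebra(2)[OF K x]
  \<comment> \<open>On a finite product every subset is measurable, so
    \<open>integral_finite_space\<close> applies to the product measure itself.\<close>
  have sP: "sets (\<kappa> x \<Otimes>\<^sub>M K x) = Pow (Y \<times> Y)"
    using fin by (intro sets_pair_countable s countable_finite)
  have m: "measure (\<kappa> x \<Otimes>\<^sub>M K x) {(y, a)} = measure (\<kappa> x) {y} * measure (K x) {a}"
    if "y \<in> Y" "a \<in> Y" for y a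
    using K.emeasure_pair_measure_Times[of "{y}" "\<kappa> x" "{a}"] that s
    by (simp add: measure_def enn2real_mult)
  have "(\<integral>(y, yhat). loss yhat y \<partial>(\<kappa> x \<Otimes>\<^sub>M K x)) =
      (\<Sum>(y, a)\<in>Y \<times> Y. loss a y * measure (\<kappa> x \<Otimes>\<^sub>M K x) {(y, a)})"
    using P.prob_space_axioms sP fin
    by (simp add: integral_finite_space split_beta)
  also have "\<dots> = (\<Sum>y\<in>Y. \<Sum>a\<in>Y. loss a y * (measure (\<kappa> x) {y} * measure (K x) {a}))"
    by (simp add: sum.cartesian_product[symmetric] m)
  also have "\<dots> = (\<Sum>a\<in>Y. measure (K x) {a} * conditional_risk loss \<kappa> x a)"
    unfolding conditional_risk_finite_space[OF k fin x]
    by (subst sum.swap) (simp add: sum_distrib_left mult_ac)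
  finally show ?thesis .
qed

text \<open>A conditional distribution is specified only through measures of rectangles. This
  suffices because \<open>Y\<close> is finite: the loss of \<open>h\<close> is a finite linear
  combination of indicators of rectangles.\<close>

lemma integral_loss_predictor:
  fixes loss :: "'y \<Rightarrow> 'y \<Rightarrow> real"
  assumes p: "prob_space p" "sets p = sets (M \<Otimes>\<^sub>M count_space Y)"
    and c: "is_cond_distribution M Y p \<kappa>"
    and fin: "finite Y" and h: "h \<in> M \<rightarrow>\<^sub>M count_space Y"
  shows "(\<integral>(x, y). loss (h x) y \<partial>p) = (\<integral>x. conditional_risk loss \<kappa> x (h x) \<partial>(distr p M fst))"
proof -
  interpret prob_space p by fact
  have k: "\<kappa> \<in> M \<rightarrow>\<^sub>M prob_algebra (count_space Y)"
    using c by (simp add: is_cond_distribution_def)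
  have fst[measurable]: "fst \<in> p \<rightarrow>\<^sub>M M"
    by (subst measurable_cong_sets[OF p(2) refl]) simp
  let ?P = "distr p M fst"
  interpret P: prob_space ?P by (rule prob_space_distr) fact
  have sp: "space p = space M \<times> Y"
    using sets_eq_imp_space_eq[OF p(2)] by (simp add: space_pair_measure)
  \<comment> \<open>The level sets of \<open>h\<close>: on \<open>H a \<times> {b}\<close> the loss
    has the constant value \<open>loss a b\<close>.\<close>
  define H where "H a = {x \<in> space M. h x = a}" for a
  have H[measurable]: "H a \<in> sets M" for a
  proof -
    \<comment> \<open>Here \<open>a\<close> is arbitrary; intersecting with \<open>Y\<close> gives a
      measurable set of \<open>count_space Y\<close> even when \<open>a\<close> lies outside
      \<open>Y\<close>.\<close>
    have "H a = h -` ({a} \<inter> Y) \<inter> space M"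
      using measurable_space[OF h] by (auto simp: H_def)
    then show ?thesis using measurable_sets[OF h, of "{a} \<inter> Y"] by (simp only:) simp
  qed
  have Hp: "H a \<times> {b} \<in> sets p" if "b \<in> Y" for a b
    using that by (simp add: p(2))
  have hY: "h x \<in> Y" if "x \<in> space M" for x using measurable_space[OF h that] by simp
  \<comment> \<open>Needed twice: to turn the nonnegative integral in \<open>pm\<close> into a
    Bochner integral, and to exchange integral and finite sums afterwards.\<close>
  have int: "integrable ?P (\<lambda>x. indicator (H a) x * measure (\<kappa> x) {b})" if "b \<in> Y" for a b
  proof (rule P.integrable_const_bound[where B = 1])
    show "AE x in ?P. norm (indicator (H a) x * measure (\<kappa> x) {b}) \<le> 1"
      using kernel_prob_algebra(1)[OF k]
      by (intro AE_I2) (auto simp: indicator_def prob_space.prob_le_1)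
    show "(\<lambda>x. indicator (H a) x * measure (\<kappa> x) {b}) \<in> borel_measurable ?P"
      using measurable_kernel_measure[OF k, of "{b}"] that by simp
  qed
  have pm: "measure p (H a \<times> {b}) = (\<integral>x. indicator (H a) x * measure (\<kappa> x) {b} \<partial>?P)"
    if "b \<in> Y" for a b
  proof -
    \<comment> \<open>The defining identity of the conditional distribution, taken on the rectangle
      with sides \<open>H a\<close> and \<open>{b}\<close>.\<close>
    have "emeasure p (H a \<times> {b}) = (\<integral>\<^sup>+x\<in>H a. emeasure (\<kappa> x) {b} \<partial>?P)"
      using c that by (simp add: is_cond_distribution_def)
    also have "\<dots> = (\<integral>\<^sup>+x. ennreal (indicator (H a) x * measure (\<kappa> x) {b}) \<partial>?P)"
    proof (intro nn_integral_cong)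
      fix x assume "x \<in> space ?P"
      then interpret Q: prob_space "\<kappa> x" using kernel_prob_algebra[OF k] by simp
      show "emeasure (\<kappa> x) {b} * indicator (H a) x = ennreal (indicator (H a) x * measure (\<kappa> x) {b})"
        by (simp add: indicator_def Q.emeasure_eq_measure)
    qed
    also have "\<dots> = ennreal (\<integral>x. indicator (H a) x * measure (\<kappa> x) {b} \<partial>?P)"
      using int[OF that] by (intro nn_integral_eq_integral) auto
    finally show ?thesis
      by (simp add: measure_def integral_nonneg_AE)
  qed
  have "(\<integral>(x, y). loss (h x) y \<partial>p) =
      (\<integral>z. (\<Sum>a\<in>Y. \<Sum>b\<in>Y. loss a b * indicator (H a \<times> {b}) z) \<partial>p)"
  proof (intro Bochner_Integration.integral_cong refl)
    fix z assume "z \<in> space p"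
    then obtain x y where z: "z = (x, y)" "x \<in> space M" "y \<in> Y" by (auto simp: sp)
    have "(\<Sum>a\<in>Y. \<Sum>b\<in>Y. loss a b * indicator (H a \<times> {b}) z) =
        (\<Sum>a\<in>Y. \<Sum>b\<in>Y. if b = y then if a = h x then loss a b else 0 else 0)"
      using z by (intro sum.cong) (auto simp: indicator_def H_def)
    also have "\<dots> = loss (h x) y" using z fin hY by simp
    finally show "(case z of (x, y) \<Rightarrow> loss (h x) y) =
        (\<Sum>a\<in>Y. \<Sum>b\<in>Y. loss a b * indicator (H a \<times> {b}) z)" using z by simp
  qed
  also have "\<dots> = (\<Sum>a\<in>Y. \<Sum>b\<in>Y. loss a b * measure p (H a \<times> {b}))"
    using Hp by (simp add: Bochner_Integration.integral_sum less_top[symmetric] sets.Int_space_eq2)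
  also have "\<dots> = (\<integral>x. (\<Sum>a\<in>Y. \<Sum>b\<in>Y. loss a b * (indicator (H a) x * measure (\<kappa> x) {b})) \<partial>?P)"
    using int by (simp add: Bochner_Integration.integral_sum pm)
  also have "\<dots> = (\<integral>x. conditional_risk loss \<kappa> x (h x) \<partial>?P)"
  proof (intro Bochner_Integration.integral_cong refl)
    fix x assume "x \<in> space ?P"
    then have x: "x \<in> space M" by simp
    have "(\<Sum>a\<in>Y. \<Sum>b\<in>Y. loss a b * (indicator (H a) x * measure (\<kappa> x) {b})) =
        (\<Sum>a\<in>Y. if a = h x then \<Sum>b\<in>Y. loss a b * measure (\<kappa> x) {b} else 0)"
      using x by (intro sum.cong) (auto simp: indicator_def H_def)
    also have "\<dots> = conditional_risk loss \<kappa> x (h x)"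
      using x fin hY by (simp add: conditional_risk_finite_space[OF k])
    finally show "(\<Sum>a\<in>Y. \<Sum>b\<in>Y. loss a b * (indicator (H a) x * measure (\<kappa> x) {b})) =
        conditional_risk loss \<kappa> x (h x)" .
  qed
  finally show ?thesis .
qed

section \<open>Measurable selection and the strict gap between risks\<close>

text \<open>Ties are broken by a fixed enumeration of \<open>Y\<close>: the first minimizer in the
  list is selected, and its index is measurable as the least index satisfying measurable
  predicates.\<close>

lemma measurable_arg_min_finite:
  fixes r :: "'x \<Rightarrow> 'y \<Rightarrow> real"
  assumes fin: "finite Y" "Y \<noteq> {}"
    and r: "\<And>a. a \<in> Y \<Longrightarrow> (\<lambda>x. r x a) \<in> borel_measurable M"
  obtains h where "h \<in> M \<rightarrow>\<^sub>M count_space Y" "\<And>x a. a \<in> Y \<Longrightarrow> r x (h x) \<le> r x a"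
proof -
  obtain ys where ys: "set ys = Y" using fin finite_list by auto
  define Q where "Q n x \<longleftrightarrow> n < length ys \<and> (\<forall>a\<in>Y. r x (ys ! n) \<le> r x a)" for n x
  define k where "k x = (LEAST n. Q n x)" for x
  have ex: "Q (k x) x" for x
  proof -
    obtain a where a: "a \<in> Y" "\<forall>b\<in>Y. r x a \<le> r x b"
      using ex_is_arg_min_if_finite[OF fin, of "r x"] by (auto simp: is_arg_min_linorder)
    then obtain n where "n < length ys" "ys ! n = a" using ys by (auto simp: in_set_conv_nth)
    then have "Q n x" using a by (simp add: Q_def)
    then show ?thesis unfolding k_def by (rule LeastI)
  qed
  have Q: "Measurable.pred M (Q n)" for n
  proof (cases "n < length ys")
    case True
    then have "ys ! n \<in> Y" using ys by auto
    then have "Measurable.pred M (\<lambda>x. \<forall>a\<in>Y. r x (ys ! n) \<le> r x a)"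
      using fin(1) r by (intro pred_intros_finite) simp_all
    then show ?thesis using True by (simp add: Q_def[abs_def])
  next
    case False
    then show ?thesis by (simp add: Q_def[abs_def])
  qed
  have km: "k \<in> M \<rightarrow>\<^sub>M count_space UNIV"
    unfolding k_def[abs_def] using Q by (intro measurable_Least) auto
  show thesis
  proof
    show "(\<lambda>x. ys ! k x) \<in> M \<rightarrow>\<^sub>M count_space Y"
    proof (subst measurable_count_space_eq2[OF fin(1)], intro conjI ballI)
      show "(\<lambda>x. ys ! k x) \<in> space M \<rightarrow> Y" using ex ys by (auto simp: Q_def)
      fix a
      have "(\<lambda>x. ys ! k x) -` {a} \<inter> space M = k -` {n. ys ! n = a} \<inter> space M" by auto
      then show "(\<lambda>x. ys ! k x) -` {a} \<inter> space M \<in> sets M"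
        using measurable_sets[OF km, of "{n. ys ! n = a}"] by simp
    qed
    show "r x (ys ! k x) \<le> r x a" if "a \<in> Y" for x a
      using ex[of x] that by (simp add: Q_def)
  qed
qed

text \<open>A weighted average of conditional risks is never below their minimum, and lies above it
  once a non-minimizer has positive weight. Hypothesis \<open>sub\<close> expresses non-minimality
  by a strictly better competitor \<open>b\<close>.\<close>

lemma minimal_risk_less_decoder_risk:
  fixes loss :: "'y \<Rightarrow> 'y \<Rightarrow> real"
  assumes p: "prob_space p" "sets p = sets (M \<Otimes>\<^sub>M count_space Y)"
    and c: "is_cond_distribution M Y p \<kappa>"
    and fin: "finite Y" and nonneg: "\<And>a b. 0 \<le> loss a b"
    and K: "K \<in> M \<rightarrow>\<^sub>M prob_algebra (count_space Y)"
    and S: "S \<in> sets M" "measure (distr p M fst) S \<noteq> 0"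
    and sub: "\<And>x. x \<in> S \<Longrightarrow> \<exists>a\<in>Y. measure (K x) {a} \<noteq> 0 \<and>
      (\<exists>b\<in>Y. conditional_risk loss \<kappa> x b < conditional_risk loss \<kappa> x a)"
  shows "minimal_risk loss M Y p < decoder_risk loss M p \<kappa> K"
proof -
  let ?r = "conditional_risk loss \<kappa>"
  let ?P = "distr p M fst"
  interpret prob_space p by fact
  have k: "\<kappa> \<in> M \<rightarrow>\<^sub>M prob_algebra (count_space Y)"
    using c by (simp add: is_cond_distribution_def)
  have fst: "fst \<in> p \<rightarrow>\<^sub>M M"
    by (subst measurable_cong_sets[OF p(2) refl]) simp
  interpret P: prob_space ?P by (rule prob_space_distr) fact
  \<comment> \<open>An empty \<open>Y\<close> would make the space of the probability measure
    \<open>p\<close> empty.\<close>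
  have "Y \<noteq> {}"
    using not_empty sets_eq_imp_space_eq[OF p(2)] by (auto simp: space_pair_measure)
  note r = measurable_conditional_risk[OF k fin, of loss]
  obtain h where h: "h \<in> M \<rightarrow>\<^sub>M count_space Y" and hmin: "\<And>x a. a \<in> Y \<Longrightarrow> ?r x (h x) \<le> ?r x a"
    using measurable_arg_min_finite[OF fin \<open>Y \<noteq> {}\<close>, of ?r M] r by metis
  \<comment> \<open>Summing the bounds over all actions gives one constant, uniform in both
    \<open>x\<close> and \<open>a\<close>; it dominates both integrands below.\<close>
  define B where "B = (\<Sum>a\<in>Y. \<Sum>y\<in>Y. \<bar>loss a y\<bar>)"
  have B: "\<bar>?r x a\<bar> \<le> B" if "x \<in> space M" "a \<in> Y" for x a
    unfolding B_def
    by (rule order_trans[OF abs_conditional_risk_le[OF k fin that(1)]])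
      (rule member_le_sum, use that fin in \<open>auto intro: sum_nonneg\<close>)
  have hY: "h x \<in> Y" if "x \<in> space M" for x using measurable_space[OF h that] by simp
  \<comment> \<open>The inner integral of \<open>decoder_risk\<close>, in the form given by
    \<open>integral_loss_product\<close>.\<close>
  let ?d = "\<lambda>x. \<Sum>a\<in>Y. measure (K x) {a} * ?r x a"
  have sum1: "(\<Sum>a\<in>Y. measure (K x) {a}) = 1" if "x \<in> space M" for x
  proof -
    interpret Q: prob_space "K x" using kernel_prob_algebra[OF K that] by simp
    have "(\<integral>y. 1 \<partial>K x) = (\<Sum>y\<in>Y. 1 * measure (K x) {y})"
      by (rule integral_finite_space[OF kernel_prob_algebra[OF K that] fin])
    then show ?thesis using Q.prob_space by simp
  qed
  have const: "(\<Sum>a\<in>Y. measure (K x) {a} * t) = t" if "x \<in> space M" for x t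
    using sum1[OF that] by (simp add: sum_distrib_right[symmetric])
  have le: "?r x (h x) \<le> ?d x" if "x \<in> space M" for x
    using const[OF that, of "?r x (h x)"] hmin
    by (metis (no_types, lifting) mult_left_mono measure_nonneg sum_mono)
  have less: "?r x (h x) < ?d x" if xS: "x \<in> S" for x
  proof -
    have x: "x \<in> space M" using xS S(1) sets.sets_into_space by auto
    obtain a b where ab: "a \<in> Y" "measure (K x) {a} \<noteq> 0" "b \<in> Y" "?r x b < ?r x a"
      using sub[OF xS] by auto
    have pos: "measure (K x) {a} > 0" using ab(2) measure_nonneg[of "K x" "{a}"] by linarith
    have "?r x (h x) < ?r x a" using hmin[OF ab(3), of x] ab(4) by simp
    \<comment> \<open>Every term is at most its counterpart, and the term at the suboptimal output
      \<open>a\<close> is strictly smaller because its weight is positive.\<close>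
    then have "(\<Sum>a\<in>Y. measure (K x) {a} * ?r x (h x)) < ?d x"
      using ab(1) pos hmin
      by (intro sum_strict_mono_ex1[OF fin]) (auto intro!: mult_left_mono bexI[of _ a])
    then show ?thesis by (simp add: const[OF x])
  qed
  have ih: "integrable ?P (\<lambda>x. ?r x (h x))"
  proof (rule P.integrable_const_bound[where B = B])
    show "AE x in ?P. norm (?r x (h x)) \<le> B" using B hY by (intro AE_I2) auto
    show "(\<lambda>x. ?r x (h x)) \<in> borel_measurable ?P"
      \<comment> \<open>The index \<open>h x\<close> varies with \<open>x\<close> but takes values
        in the finite set \<open>Y\<close>, so measurability for each fixed action is
        enough.\<close>
      using measurable_compose_countable'[of Y "\<lambda>a x. ?r x a" M borel h] r h fin
      by (simp add: countable_finite)
  qed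
  have dB: "\<bar>?d x\<bar> \<le> B" if "x \<in> space M" for x
  proof -
    have "\<bar>?d x\<bar> \<le> (\<Sum>a\<in>Y. measure (K x) {a} * B)"
      using B[OF that]
      by (intro order_trans[OF sum_abs] sum_mono) (auto simp: abs_mult intro: mult_left_mono)
    then show ?thesis by (simp add: const[OF that])
  qed
  have id: "integrable ?P ?d"
  proof (rule P.integrable_const_bound[where B = B])
    show "AE x in ?P. norm (?d x) \<le> B" using dB by (intro AE_I2) auto
    have "?d \<in> borel_measurable M"
      using measurable_kernel_measure[OF K] r by (intro borel_measurable_sum borel_measurable_times) auto
    then show "?d \<in> borel_measurable ?P" by simp
  qed
  have "minimal_risk loss M Y p \<le> (\<integral>(x, y). loss (h x) y \<partial>p)"
    unfolding minimal_risk_def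
    \<comment> \<open>A real infimum is a lower bound only for a family bounded below; nonnegativity
      of the loss supplies the bound 0.\<close>
    by (rule cINF_lower[OF _ h], rule bdd_belowI2[where m = 0])
      (auto intro!: integral_nonneg_AE simp: nonneg split_beta)
  also have "\<dots> = (\<integral>x. ?r x (h x) \<partial>?P)"
    by (rule integral_loss_predictor[OF p c fin h])
  also have "\<dots> < (\<integral>x. ?d x \<partial>?P)"
  \<comment> \<open>Strictness survives integration: the integrands are ordered everywhere and
    differ on \<open>S\<close>, which is not a null set.\<close>
  proof (rule P.integral_less_AE[OF ih id, of S])
    show "emeasure ?P S \<noteq> 0" using S(2) by (metis measure_eq_emeasure_eq_ennreal measure_def enn2real_0)
    show "AE x in ?P. x \<in> S \<longrightarrow> ?r x (h x) \<noteq> ?d x" using less by (intro AE_I2) force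
  qed (use S le in auto)
  also have "\<dots> = decoder_risk loss M p \<kappa> K"
    unfolding decoder_risk_def
    by (intro Bochner_Integration.integral_cong) (auto simp: integral_loss_product[OF k K fin])
  finally show ?thesis .
qed

section \<open>The \<open>N\<close>-gram Hamming loss\<close>

text \<open>By linearity each start position contributes the probability of a mismatch, one minus
  that of a match. \<open>Suc (L - N)\<close> counts the positions from \<open>0\<close> to
  \<open>L - N\<close>, both included. Minimizing the risk is thus maximizing the score.\<close>

lemma conditional_risk_ngram_hamming_loss:
  assumes k: "\<kappa> \<in> M \<rightarrow>\<^sub>M prob_algebra (count_space Y)" and x: "x \<in> space M"
  shows "conditional_risk (ngram_hamming_loss N L) \<kappa> x a =
    real (Suc (L - N)) - ngram_score N L \<kappa> x a"
proof -
  interpret prob_space "\<kappa> x" using kernel_prob_algebra[OF k x] by simp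
  note s = kernel_prob_algebra(2)[OF k x]
  have sp: "space (\<kappa> x) = Y"
    using s by (metis sets_eq_imp_space_eq sets_count_space space_count_space)
  define E where "E i = {z \<in> space (\<kappa> x). ngram N i z = ngram N i a}" for i
  have E: "E i \<in> events" for i using s sp by (auto simp: E_def)
  have "conditional_risk (ngram_hamming_loss N L) \<kappa> x a =
      (\<integral>y. (\<Sum>i=0..L - N. 1 - indicator (E i) y) \<partial>\<kappa> x)"
    unfolding conditional_risk_def ngram_hamming_loss_def
    by (intro Bochner_Integration.integral_cong sum.cong refl) (auto simp: E_def indicator_def)
  also have "\<dots> = (\<Sum>i=0..L - N. 1 - prob (E i))"
    using E by (simp add: Bochner_Integration.integral_sum less_top[symmetric] prob_space sets.Int_space_eq2)
  also have "\<dots> = real (Suc (L - N)) - ngram_score N L \<kappa> x a"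
    by (simp add: sum_subtractf ngram_score_def E_def)
  finally show ?thesis .
qed

theorem proposition4:
  fixes M :: "'x measure"
    and V :: "'a set"
    and Y :: "'a list set"
    and N L :: nat
    and p :: "('x \<times> 'a list) measure"
    and \<kappa> :: "'x \<Rightarrow> 'a list measure"
    and D :: "('x, 'a) decoder"
    and S :: "'x set"
  assumes "finite V"
    and "Y \<subseteq> {y. set y \<subseteq> V \<and> length y = L}"
    and "1 \<le> N" and "N \<le> L"
    and "prob_space p" and "sets p = sets (M \<Otimes>\<^sub>M count_space Y)"
    and "is_cond_distribution M Y p \<kappa>"
    and "stochastic_decoder M Y D"
    and "S \<in> sets M" and "measure (distr p M fst) S \<noteq> 0"
    and "\<And>x. x \<in> S \<Longrightarrow>
           \<exists>yhat\<in>Y. measure (D (next_token_prob \<kappa>) x) {yhat} \<noteq> 0 \<and>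
             yhat \<notin> {y. is_arg_max (ngram_score N L \<kappa> x) (\<lambda>y. y \<in> Y) y}"
  shows "\<not> optimal_decoder (ngram_hamming_loss N L) M Y p \<kappa> D"
proof -
  let ?loss = "ngram_hamming_loss N L :: 'a list \<Rightarrow> 'a list \<Rightarrow> real"
  have fin: "finite Y"
    using finite_lists_length_eq[OF assms(1), of L] assms(2) by (rule rev_finite_subset)
  have k: "\<kappa> \<in> M \<rightarrow>\<^sub>M prob_algebra (count_space Y)"
    using assms(7) by (simp add: is_cond_distribution_def)
  have K: "D (next_token_prob \<kappa>) \<in> M \<rightarrow>\<^sub>M prob_algebra (count_space Y)"
    using assms(8) k by (simp add: stochastic_decoder_def)
  have "minimal_risk ?loss M Y p < decoder_risk ?loss M p \<kappa> (D (next_token_prob \<kappa>))"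
  proof (rule minimal_risk_less_decoder_risk[OF assms(5-7) fin _ K assms(9,10)])
    show "0 \<le> ?loss a b" for a b by (simp add: ngram_hamming_loss_def sum_nonneg)
    fix x assume "x \<in> S"
    moreover from this have "x \<in> space M" using assms(9) sets.sets_into_space by auto
    ultimately show "\<exists>a\<in>Y. measure (D (next_token_prob \<kappa>) x) {a} \<noteq> 0 \<and>
        (\<exists>b\<in>Y. conditional_risk ?loss \<kappa> x b < conditional_risk ?loss \<kappa> x a)"
      \<comment> \<open>Scores are real, so an element of \<open>Y\<close> that is not a maximizer
        is beaten strictly by some \<open>b\<close> in \<open>Y\<close>, which then has strictly
        smaller conditional risk.\<close>
      using assms(11)[of x]
      by (auto simp: conditional_risk_ngram_hamming_loss[OF k] is_arg_max_linorder not_le)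
  qed
  then show ?thesis by (simp add: optimal_decoder_def)
qed

end
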